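(* Let $\mathcal L$ be a cubic algebra such that for all $x,y\in\mathcal L$ the meet $x\wedge\Delta(x\vee y,y)$ exists in $\mathcal L$. Then $\mathcal L$ satisfies the MR-axiom: for all $a,b,x\in\mathcal L$ with $a<x$ and $b<x$, $\Delta(x,a)\vee b<x$ if and only if $a\wedge b$ does not exist.
   Context: A cubic algebra is a join-semilattice with greatest element $1$ and an operation $\Delta$ (only the values $\Delta(y,x)$ with $x\le y$ matter) such that: (1) $x\le y$ implies $\Delta(y,x)\vee x=y$; (2) $x\le y\le z$ implies $\Delta(z,\Delta(y,x))=\Delta(\Delta(z,y),\Delta(z,x))$; (3) $x\le y$ implies $\Delta(y,\Delta(y,x))=x$; (4) $x\le y\le z$ implies $\Delta(z,x)\le\Delta(z,y)$; and, writing $xy=\Delta(1,\Delta(x\vee y,y))\vee y$, (5) $(xy)y=x\vee y$; (6) $x(yz)=y(xz)$. Meets $a\wedge b$ are greatest lower bounds in the order of the join-semilattice; they need not exist in general. *)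

theory Defs
  imports Main
begin

definition is_meet :: "'a::order \<Rightarrow> 'a \<Rightarrow> 'a \<Rightarrow> bool" where
  "is_meet a b m \<longleftrightarrow> m \<le> a \<and> m \<le> b \<and> (\<forall>z. z \<le> a \<and> z \<le> b \<longrightarrow> z \<le> m)"

definition meet_exists :: "'a::order \<Rightarrow> 'a \<Rightarrow> bool" where
  "meet_exists a b \<longleftrightarrow> (\<exists>m. is_meet a b m)"

text \<open>The product written by juxtaposition, $xy = \Delta(1, \Delta(x \vee y, y)) \vee y$.\<close>

definition cubic_mult ::
    "('a::{semilattice_sup, order_top} \<Rightarrow> 'a \<Rightarrow> 'a) \<Rightarrow> 'a \<Rightarrow> 'a \<Rightarrow> 'a" where
  "cubic_mult \<Delta> x y = sup (\<Delta> top (\<Delta> (sup x y) y)) y"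

text \<open>The carrier is the whole type. The operation is a total function, but its value
  \<open>\<Delta> y x\<close> is unconstrained unless \<open>x \<le> y\<close>.\<close>

locale cubic_algebra =
  fixes \<Delta> :: "'a::{semilattice_sup, order_top} \<Rightarrow> 'a \<Rightarrow> 'a"
  assumes Delta_sup: "x \<le> y \<Longrightarrow> sup (\<Delta> y x) x = y"
    and Delta_distrib: "x \<le> y \<Longrightarrow> y \<le> z \<Longrightarrow> \<Delta> z (\<Delta> y x) = \<Delta> (\<Delta> z y) (\<Delta> z x)"
    and Delta_invol: "x \<le> y \<Longrightarrow> \<Delta> y (\<Delta> y x) = x"
    and Delta_mono: "x \<le> y \<Longrightarrow> y \<le> z \<Longrightarrow> \<Delta> z x \<le> \<Delta> z y"
    and mult_sup: "cubic_mult \<Delta> (cubic_mult \<Delta> x y) y = sup x y"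
    and mult_left_comm:
      "cubic_mult \<Delta> x (cubic_mult \<Delta> y z) = cubic_mult \<Delta> y (cubic_mult \<Delta> x z)"

definition MR_axiom :: "('a::{semilattice_sup, order_top} \<Rightarrow> 'a \<Rightarrow> 'a) \<Rightarrow> bool" where
  "MR_axiom \<Delta> \<longleftrightarrow>
    (\<forall>a b x. a < x \<and> b < x \<longrightarrow> (sup (\<Delta> x a) b < x \<longleftrightarrow> \<not> meet_exists a b))"

end

theory Submission
  imports Defs
begin

text \<open>Since \<open>\<Delta> x a\<close> and \<open>b\<close> lie below \<open>x\<close>, the
  claim is that their join equals \<open>x\<close> exactly when \<open>a\<close> and
  \<open>b\<close> have a meet. If the join is \<open>x\<close>, reflecting
  \<open>\<Delta> x a\<close> in it returns \<open>a\<close>, so the hypothesis on meets, applied to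
  \<open>b\<close> and \<open>\<Delta> x a\<close>, concerns \<open>b\<close> and \<open>a\<close>
  themselves. Conversely, a common lower bound \<open>m\<close> forces the join up to
  \<open>x\<close>, because \<open>m\<close> and its reflection already join to
  \<open>x\<close>.\<close>

theorem theorem2p6:
  fixes \<Delta> :: "'a::{semilattice_sup, order_top} \<Rightarrow> 'a \<Rightarrow> 'a"
  assumes "cubic_algebra \<Delta>"
    and "\<And>x y. meet_exists x (\<Delta> (sup x y) y)"
  shows "MR_axiom \<Delta>"
  unfolding MR_axiom_def
proof (intro allI impI)
  interpret cubic_algebra \<Delta> by fact
  fix a b x :: 'a
  assume "a < x \<and> b < x"
  then have ax: "a \<le> x" and bx: "b \<le> x" by auto
  have "\<Delta> x a \<le> x"
    using Delta_sup[OF ax] by (metis sup_ge1)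
  then have le: "sup (\<Delta> x a) b \<le> x"
    using bx by simp
  have "sup (\<Delta> x a) b = x \<longleftrightarrow> meet_exists a b"
  proof
    assume "sup (\<Delta> x a) b = x"
    \<comment> \<open>The join is \<open>x\<close>, so this is the involution law at
      \<open>x\<close>.\<close>
    then have "\<Delta> (sup b (\<Delta> x a)) (\<Delta> x a) = a"
      using Delta_invol[OF ax] by (simp add: sup_commute)
    then have "meet_exists b a"
      using assms(2)[of b "\<Delta> x a"] by simp
    then show "meet_exists a b"
      by (auto simp: meet_exists_def is_meet_def)
  next
    assume "meet_exists a b"
    then obtain m where m: "m \<le> a" "m \<le> b"
      by (auto simp: meet_exists_def is_meet_def)
    \<comment> \<open>Each joinand is then enlarged separately: \<open>\<Delta> x m\<close> to
      \<open>\<Delta> x a\<close> by monotonicity, and \<open>m\<close> to \<open>b\<close>.\<close>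
    have "x = sup (\<Delta> x m) m"
      using Delta_sup[of m x] m(1) ax by simp
    also have "\<dots> \<le> sup (\<Delta> x a) b"
      using Delta_mono[OF m(1) ax] m(2) by (rule sup_mono)
    finally show "sup (\<Delta> x a) b = x"
      using le by simp
  qed
  then show "sup (\<Delta> x a) b < x \<longleftrightarrow> \<not> meet_exists a b"
    using le by (auto simp: less_le)
qed

end
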